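(* For every integer $n\ge 1$, there exists a common subsequence of $\mu^n(0)$ and $\mu^n(1)$ of length at least $2^n\left(1-\frac{1}{n/4}\right)$.
   Context: $\mu$ is the morphism on binary words defined by $\mu(0)=01$, $\mu(1)=10$, and $\mu^n$ is its $n$-fold iterate (so $\mu^n(0)$, the $n$-th Thue–Morse word, and $\mu^n(1)$, its bitwise complement, have length $2^n$). A common subsequence of two words is a word that is a (not necessarily contiguous) subsequence of both. *)

theory Defs
  imports Complex_Main "HOL-Library.Sublist" "HOL-Library.Z2"
begin

text \<open>Binary words are lists over the two-element type \<^typ>\<open>bit\<close>, of which only the
  letters 0 and 1 are used, not the field structure.\<close>

definition tm_letter :: "bit \<Rightarrow> bit list" where
  "tm_letter b = (if b = 0 then [0, 1] else [1, 0])"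

definition tm_morphism :: "bit list \<Rightarrow> bit list" where
  "tm_morphism w = concat (map tm_letter w)"

lemma tm_morphism_append: "tm_morphism (u @ v) = tm_morphism u @ tm_morphism v"
  by (simp add: tm_morphism_def)

lemma tm_morphism_zero: "tm_morphism [0] = [0, 1]"
  and tm_morphism_one: "tm_morphism [1] = [1, 0]"
  by (simp_all add: tm_morphism_def tm_letter_def)

definition common_subseq :: "'a list \<Rightarrow> 'a list \<Rightarrow> 'a list \<Rightarrow> bool" where
  "common_subseq w u v \<longleftrightarrow> subseq w u \<and> subseq w v"

end

theory Submission
  imports Defs
begin

text \<open>
  Write \<open>\<mu>\<^sup>m\<^sup>+\<^sup>k(b) = \<mu>\<^sup>m(\<mu>\<^sup>k(b))\<close> and align \<open>\<mu>\<^sup>k(0)\<close> without its first letter with \<open>\<mu>\<^sup>k(1)\<close>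
  without its last letter. As \<open>\<mu>\<^sup>k(1)\<close> is the complement of \<open>\<mu>\<^sup>k(0)\<close>, the letters disagree exactly
  at the adjacent equal pairs of \<open>\<mu>\<^sup>k(0)\<close>, of which there are at most \<open>2\<^sup>k / 3\<close>. Where the letters
  agree, whole blocks \<open>\<mu>\<^sup>m(b)\<close> match; where they disagree, a common subsequence of \<open>\<mu>\<^sup>m(0)\<close> and
  \<open>\<mu>\<^sup>m(1)\<close> is used. The fraction \<open>f\<close> of omitted letters thus satisfies
  \<open>f(m + k) \<le> 2\<^sup>-\<^sup>k + f(m) / 3\<close>, and with \<open>k = \<lfloor>n / 2\<rfloor>\<close>, \<open>m = n - k\<close> the bound \<open>f(n) \<le> 4 / n\<close>
  follows by strong induction.
\<close>

lemma tm_power_append: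
  "(tm_morphism ^^ m) (u @ v) = (tm_morphism ^^ m) u @ (tm_morphism ^^ m) v"
  by (induction m) (simp_all add: tm_morphism_append)

lemma tm_power_Cons:
  "(tm_morphism ^^ m) (a # v) = (tm_morphism ^^ m) [a] @ (tm_morphism ^^ m) v"
  using tm_power_append[of m "[a]" v] by simp

lemma length_tm_morphism: "length (tm_morphism w) = 2 * length w"
  by (induction w) (simp_all add: tm_morphism_def tm_letter_def)

lemma length_tm_power: "length ((tm_morphism ^^ m) w) = 2 ^ m * length w"
  by (induction m) (simp_all add: length_tm_morphism)

lemma tm_morphism_complement:
  "tm_morphism (map (\<lambda>b. b + 1) w) = map (\<lambda>b. b + 1) (tm_morphism w)"
  by (induction w) (auto simp: tm_morphism_def tm_letter_def)

lemma tm_power_one: "(tm_morphism ^^ k) [1] = map (\<lambda>b. b + 1) ((tm_morphism ^^ k) [0])"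
proof (induction k)
  case (Suc k)
  then show ?case
    by (simp only: funpow.simps comp_apply tm_morphism_complement)
qed simp

fun adjacent_equal :: "'a list \<Rightarrow> nat" where
  "adjacent_equal (a # b # w) = (if a = b then 1 else 0) + adjacent_equal (b # w)"
| "adjacent_equal _ = 0"

text \<open>The two letters of each block differ, so equal neighbours occur only across a block
  boundary; since \<open>tm_letter a\<close> ends in \<open>a + 1\<close>, this happens exactly
  where the neighbours \<open>a\<close>, \<open>b\<close> in \<open>w\<close> differ.\<close>

lemma adjacent_equal_tm_morphism:
  "w \<noteq> [] \<Longrightarrow> adjacent_equal (tm_morphism w) + adjacent_equal w + 1 = length w"
  by (induction w rule: adjacent_equal.induct)
    (auto simp: tm_morphism_def tm_letter_def split: if_splits)

text \<open>The recurrence e(k+1) = 2^k - 1 - e(k) reverses inequalities, so each bound at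
  \<open>Suc k\<close> needs the other one at \<open>k\<close>.\<close>

lemma adjacent_equal_tm_power:
  "3 * adjacent_equal ((tm_morphism ^^ k) [b]) \<le> 2 ^ k \<and>
   2 ^ k \<le> 3 * adjacent_equal ((tm_morphism ^^ k) [b]) + 3"
proof (induction k)
  case (Suc k)
  let ?w = "(tm_morphism ^^ k) [b]"
  have "length ?w = 2 ^ k"
    by (simp add: length_tm_power)
  moreover from this have "?w \<noteq> []"
    by (metis length_0_conv power_not_zero zero_neq_numeral)
  ultimately show ?case
    using Suc adjacent_equal_tm_morphism[of ?w] by simp
qed simp

lemma common_subseq_append:
  "common_subseq w u v \<Longrightarrow> common_subseq w' u' v' \<Longrightarrow> common_subseq (w @ w') (u @ u') (v @ v')"
  by (simp add: common_subseq_def list_emb_append_mono)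

text \<open>The summand \<open>2 ^ m\<close> pays for the block lost to the shift; each disagreement
  costs \<open>2 ^ m - length w\<close>. Taking \<open>x\<close> arbitrary lets the induction strip
  one letter at a time.\<close>

lemma shifted_complement_common_subseq:
  assumes w: "common_subseq w ((tm_morphism ^^ m) [0]) ((tm_morphism ^^ m) [1])"
    and "x \<noteq> []"
  shows "\<exists>z. common_subseq z ((tm_morphism ^^ m) (tl x))
               ((tm_morphism ^^ m) (butlast (map (\<lambda>b. b + 1) x)))
             \<and> 2 ^ m * length x \<le> length z + 2 ^ m + adjacent_equal x * (2 ^ m - length w)"
  using \<open>x \<noteq> []\<close>
proof (induction x rule: adjacent_equal.induct)
  case (1 a b x)
  then obtain z where z: "common_subseq z ((tm_morphism ^^ m) x)
      ((tm_morphism ^^ m) (butlast (map (\<lambda>b. b + 1) (b # x))))"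
    and len: "2 ^ m * length (b # x)
      \<le> length z + 2 ^ m + adjacent_equal (b # x) * (2 ^ m - length w)"
    by auto
  define y where "y = (if a = b then w else (tm_morphism ^^ m) [b])"
  \<comment> \<open>Over \<open>bit\<close>, \<open>a \<noteq> b\<close> means
    \<open>b = a + 1\<close>, so the two blocks coincide; otherwise they are the two different
    blocks, in either order.\<close>
  have "common_subseq y ((tm_morphism ^^ m) [b]) ((tm_morphism ^^ m) [a + 1])"
    using w by (cases a; cases b) (auto simp: y_def common_subseq_def)
  from common_subseq_append[OF this z]
  have "common_subseq (y @ z) ((tm_morphism ^^ m) (tl (a # b # x)))
      ((tm_morphism ^^ m) (butlast (map (\<lambda>b. b + 1) (a # b # x))))"
    by (simp flip: tm_power_append)
  moreover have "2 ^ m \<le> length y + (if a = b then 2 ^ m - length w else 0)"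
    using le_diff_conv[of "2 ^ m" "length w" "2 ^ m - length w"]
    by (simp add: y_def length_tm_power add.commute)
  then have "2 ^ m * length (a # b # x)
      \<le> length (y @ z) + 2 ^ m + adjacent_equal (a # b # x) * (2 ^ m - length w)"
    using len by (auto simp: algebra_simps)
  ultimately show ?case
    by blast
next
  case ("2_2" a)
  show ?case
    by (rule exI[of _ "[]"]) (simp add: common_subseq_def)
qed simp

text \<open>This is the recurrence for f, multiplied by \<open>3 * 2 ^ (m + k)\<close> to stay
  within the naturals.\<close>

lemma common_subseq_tm_power_add:
  assumes w: "common_subseq w ((tm_morphism ^^ m) [0]) ((tm_morphism ^^ m) [1])"
  shows "\<exists>z. common_subseq z ((tm_morphism ^^ (m + k)) [0]) ((tm_morphism ^^ (m + k)) [1])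
             \<and> 3 * 2 ^ (m + k) \<le> 3 * length z + 3 * 2 ^ m + 2 ^ k * (2 ^ m - length w)"
proof -
  define x where "x = (tm_morphism ^^ k) [0]"
  have len_x: "length x = 2 ^ k"
    by (simp add: x_def length_tm_power)
  then have "x \<noteq> []"
    by (metis length_0_conv power_not_zero zero_neq_numeral)
  then obtain z where z: "common_subseq z ((tm_morphism ^^ m) (tl x))
      ((tm_morphism ^^ m) (butlast (map (\<lambda>b. b + 1) x)))"
    and len: "2 ^ m * length x \<le> length z + 2 ^ m + adjacent_equal x * (2 ^ m - length w)"
    using shifted_complement_common_subseq[OF w] by blast
  \<comment> \<open>Putting the omitted end blocks back only lengthens both words.\<close>
  have "common_subseq z ((tm_morphism ^^ m) x) ((tm_morphism ^^ m) (map (\<lambda>b. b + 1) x))"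
  proof -
    have "(tm_morphism ^^ m) x = (tm_morphism ^^ m) [hd x] @ (tm_morphism ^^ m) (tl x)"
      using \<open>x \<noteq> []\<close> by (simp flip: tm_power_append)
    moreover have "(tm_morphism ^^ m) (map (\<lambda>b. b + 1) x)
        = (tm_morphism ^^ m) (butlast (map (\<lambda>b. b + 1) x))
          @ (tm_morphism ^^ m) [last (map (\<lambda>b. b + 1) x)]"
      using \<open>x \<noteq> []\<close> by (simp flip: tm_power_append)
    ultimately show ?thesis
      using z by (simp add: common_subseq_def list_emb_append2 subseq_rev_drop_many list_emb_prefix)
  qed
  moreover have "(tm_morphism ^^ (m + k)) [0] = (tm_morphism ^^ m) x"
    "(tm_morphism ^^ (m + k)) [1] = (tm_morphism ^^ m) (map (\<lambda>b. b + 1) x)"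
    by (simp_all add: x_def tm_power_one funpow_add)
  moreover have "3 * adjacent_equal x * (2 ^ m - length w) \<le> 2 ^ k * (2 ^ m - length w)"
    using adjacent_equal_tm_power[of k 0] by (simp add: x_def)
  then have "3 * 2 ^ (m + k) \<le> 3 * length z + 3 * 2 ^ m + 2 ^ k * (2 ^ m - length w)"
    using len unfolding len_x power_add mult.assoc by linarith
  ultimately show ?thesis
    by auto
qed

text \<open>With \<open>n \<le> 2 * k + 1\<close> this bounds the shift loss 2^-k by 4 / (3n). It
  fails at \<open>k = 1\<close>.\<close>

lemma six_mult_le_power: "k \<ge> 2 \<Longrightarrow> 6 * k + 3 \<le> 4 * (2 :: nat) ^ k"
  by (induction k rule: dec_induct) simp_all

theorem theorem2:
  fixes n :: nat
  assumes "n \<ge> 1"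
  shows "\<exists>w. common_subseq w ((tm_morphism ^^ n) [0]) ((tm_morphism ^^ n) [1])
             \<and> real (length w) \<ge> 2 ^ n * (1 - 1 / (real n / 4))"
  using assms
proof (induction n rule: less_induct)
  case (less n)
  show ?case
  proof (cases "n < 4")
    case True
    then have "(2 :: real) ^ n * (1 - 1 / (real n / 4)) \<le> 0"
      using less.prems by (simp add: mult_le_0_iff field_simps)
    then show ?thesis
      by (intro exI[of _ "[]"]) (simp add: common_subseq_def)
  next
    case False
    \<comment> \<open>Halving keeps 2^-k of order at most 1/n and gives 4 / m \<le> 8 / n.\<close>
    define k m where "k = n div 2" and "m = n - k"
    have k: "k \<ge> 2" "2 * k \<le> n" "n \<le> 2 * k + 1" "n = m + k" "n \<le> 2 * m" "m < n" "m \<ge> 1"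
      using False by (auto simp: k_def m_def)
    obtain w where w: "common_subseq w ((tm_morphism ^^ m) [0]) ((tm_morphism ^^ m) [1])"
      and len_w: "real (length w) \<ge> 2 ^ m * (1 - 1 / (real m / 4))"
      using less.IH k by blast
    obtain z where z: "common_subseq z ((tm_morphism ^^ n) [0]) ((tm_morphism ^^ n) [1])"
      and len_z: "3 * 2 ^ n \<le> 3 * length z + 3 * 2 ^ m + 2 ^ k * (2 ^ m - length w)"
      using common_subseq_tm_power_add[OF w, of k] k by auto
    \<comment> \<open>Hence the truncated difference \<open>2 ^ m - length w\<close> is the real
      one.\<close>
    have "length w \<le> 2 ^ m"
      using w list_emb_length[of _ w] by (fastforce simp: common_subseq_def length_tm_power)
    then have loss_w: "real (2 ^ m - length w) \<le> 2 ^ m * (8 / real n)"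
    proof -
      have "4 / real m \<le> 8 / real n"
        using k by (simp add: field_simps)
      then have "(2 :: real) ^ m * (4 / real m) \<le> 2 ^ m * (8 / real n)"
        by (intro mult_left_mono) auto
      moreover have "real (2 ^ m - length w) \<le> 2 ^ m * (4 / real m)"
        using len_w \<open>length w \<le> 2 ^ m\<close> by (simp add: of_nat_diff algebra_simps)
      ultimately show ?thesis
        by linarith
    qed
    have "3 * n \<le> 4 * 2 ^ k"
      using six_mult_le_power[of k] k by linarith
    then have "real (3 * n) \<le> real (4 * 2 ^ k)"
      by (rule of_nat_mono)
    then have "3 \<le> 2 ^ k * (4 / real n)"
      using False by (simp add: field_simps)
    then have "2 ^ m * 3 \<le> 2 ^ m * (2 ^ k * (4 / real n))"
      by (intro mult_left_mono) auto
    then have shift: "3 * 2 ^ m \<le> 2 ^ n * (4 / real n)"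
      by (simp add: k(4) power_add mult.assoc)
    have "2 ^ k * real (2 ^ m - length w) \<le> 2 ^ k * (2 ^ m * (8 / real n))"
      using loss_w by (intro mult_left_mono) auto
    then have blocks: "2 ^ k * real (2 ^ m - length w) \<le> 2 ^ n * (8 / real n)"
      by (simp add: k(4) power_add mult_ac)
    have "real (3 * 2 ^ n)
        \<le> real (3 * length z + 3 * 2 ^ m + 2 ^ k * (2 ^ m - length w))"
      using len_z by (rule of_nat_mono)
    then have "3 * 2 ^ n \<le> 3 * real (length z) + 3 * 2 ^ m + 2 ^ k * real (2 ^ m - length w)"
      by simp
    \<comment> \<open>The losses 4 / n and 8 / n add up to 12 / n, three times the allowed 4 /
      n.\<close>
    with shift blocks have "2 ^ n * (1 - 1 / (real n / 4)) \<le> real (length z)"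
      by (simp add: algebra_simps)
    with z show ?thesis
      by blast
  qed
qed

end
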